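(* Let $g:S\to F$ be such that the function $f:K\to\mathbb{F}_2$, $f(\lambda u)=tr(\lambda g(u))$ ($\lambda\in F$, $u\in S$), is bent. Then: (1) If $g(u)\neq0$ for all $u\in S$, then $\{u/g(u):u\in S\}$ is an oval in $K$ with nucleus $0$. (2) There are exactly $q(q-1)/2$ elements $c\in K$ such that $g(u)+cu+\bar c\bar u\neq0$ for all $u\in S$, and for each such $c$ the set $\{u/(g(u)+cu+\bar c\bar u):u\in S\}$ is an oval in $K$ with nucleus $0$. (3) The set $\{u/g(u):u\in S\}\cup\{0\}$, where $u/g(u)$ is interpreted as the point $u_\infty$ whenever $g(u)=0$, is a hyperoval in $\overline{K}$.
   Context: Let $m\ge1$, $q=2^m$, $F=\mathbb{F}_{q}\subseteq K=\mathbb{F}_{q^2}$, $\bar x=x^q$, $T(x)=x+\bar x$, $tr:F\to\mathbb{F}_2$ and $Tr:K\to\mathbb{F}_2$ absolute traces, $S=\{u\in K:u\bar u=1\}$ (every nonzero $x\in K$ is uniquely $\lambda u$, $\lambda\in F^*$, $u\in S$). $f$ is bent if $\sum_{x\in K}(-1)^{f(x)+Tr(bx)}=\pm q$ for all $b\in K$. $K$ is regarded as the affine plane $AG(2,q)$; $\overline{K}=K\cup\{u_\infty:u\in S\}$ is its projective completion, where $u_\infty$ denotes the point at infinity of the line $uF=\{\lambda u:\lambda\in F\}$ (i.e. of the parallel class of lines with direction $u$), the $u_\infty$ together forming the line at infinity. An oval is a set of $q+1$ points no three collinear; a tangent of an oval is a line meeting it in exactly one point, and the nucleus of an oval is the unique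 point through which all its tangents pass. An oval in $K$ with nucleus $0$ is an oval contained in $K$ whose nucleus is $0\in K$. A hyperoval is a set of $q+2$ points of the projective plane, no three collinear. *)

theory Defs
  imports "HOL-Library.Cardinality"
begin

text \<open>
  Throughout, the type \<open>'k\<close> is the field \<open>K\<close> with \<open>q\<^sup>2\<close> elements, where \<open>q = 2 ^ m\<close>. The subfield
  with \<open>q\<close> elements is the fixed set of the Frobenius map \<open>x \<mapsto> x ^ q\<close>, and the prime field \<open>\<bbbF>\<^sub>2\<close>
  is the subset \<open>{0, 1}\<close> of \<open>K\<close>.
\<close>

definition conj_q :: "nat \<Rightarrow> 'k::field \<Rightarrow> 'k" where
  "conj_q q x = x ^ q"

definition subfield_q :: "nat \<Rightarrow> 'k::field set" where
  "subfield_q q = {x. x ^ q = x}"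

definition unit_circle :: "nat \<Rightarrow> 'k::field set" where
  "unit_circle q = {u. u * conj_q q u = 1}"

text \<open>
  \<open>abs_trace n\<close>, restricted to the subfield with \<open>2 ^ n\<close> elements, is the trace from that subfield to
  \<open>\<bbbF>\<^sub>2\<close>: the sum of the conjugates. So \<open>tr\<close> is \<open>abs_trace m\<close> (applied to elements of \<open>subfield_q q\<close>
  only) and \<open>Tr\<close> is \<open>abs_trace (2 * m)\<close>.
\<close>

definition abs_trace :: "nat \<Rightarrow> 'k::field \<Rightarrow> 'k" where
  "abs_trace n x = (\<Sum>i<n. x ^ (2 ^ i))"

text \<open>\<open>(-1) ^ y\<close> for \<open>y\<close> in \<open>\<bbbF>\<^sub>2 = {0, 1}\<close>.\<close>

definition sign_F2 :: "'k::field \<Rightarrow> int" where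
  "sign_F2 y = (if y = 0 then 1 else -1)"

definition bent :: "nat \<Rightarrow> ('k::{field,finite} \<Rightarrow> 'k) \<Rightarrow> bool" where
  "bent m f \<longleftrightarrow>
     (\<forall>b. (\<Sum>x\<in>UNIV. sign_F2 (f x + abs_trace (2 * m) (b * x))) \<in> {2 ^ m, - (2 ^ m)})"

text \<open>
  The projective completion of \<open>K\<close>, viewed as the affine plane over \<open>subfield_q q\<close>. Every
  one-dimensional subspace is spanned by exactly one \<open>u\<close> in \<open>unit_circle q\<close>, so the points at infinity
  are the \<open>At_Infinity u\<close> with such \<open>u\<close>; the other values of that constructor are not points.
\<close>

datatype 'k proj_point = Affine 'k | At_Infinity 'k

definition proj_points :: "nat \<Rightarrow> 'k::field proj_point set" where
  "proj_points q = range Affine \<union> At_Infinity ` unit_circle q"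

definition affine_line :: "nat \<Rightarrow> 'k::field \<Rightarrow> 'k \<Rightarrow> 'k set" where
  "affine_line q a u = {a + t * u |t. t \<in> subfield_q q}"

definition proj_lines :: "nat \<Rightarrow> 'k::field proj_point set set" where
  "proj_lines q =
     {insert (At_Infinity u) (Affine ` affine_line q a u) |a u. u \<in> unit_circle q}
     \<union> {At_Infinity ` unit_circle q}"

definition no_three_collinear :: "nat \<Rightarrow> 'k::field proj_point set \<Rightarrow> bool" where
  "no_three_collinear q X \<longleftrightarrow>
     (\<forall>P\<in>X. \<forall>Q\<in>X. \<forall>R\<in>X. P \<noteq> Q \<and> P \<noteq> R \<and> Q \<noteq> R \<longrightarrow>
        \<not> (\<exists>L\<in>proj_lines q. P \<in> L \<and> Q \<in> L \<and> R \<in> L))"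

definition oval :: "nat \<Rightarrow> 'k::field proj_point set \<Rightarrow> bool" where
  "oval q X \<longleftrightarrow> X \<subseteq> proj_points q \<and> card X = q + 1 \<and> no_three_collinear q X"

definition hyperoval :: "nat \<Rightarrow> 'k::field proj_point set \<Rightarrow> bool" where
  "hyperoval q X \<longleftrightarrow> X \<subseteq> proj_points q \<and> card X = q + 2 \<and> no_three_collinear q X"

definition tangents :: "nat \<Rightarrow> 'k::field proj_point set \<Rightarrow> 'k proj_point set set" where
  "tangents q X = {L \<in> proj_lines q. card (L \<inter> X) = 1}"

definition nucleus :: "nat \<Rightarrow> 'k::field proj_point set \<Rightarrow> 'k proj_point \<Rightarrow> bool" where
  "nucleus q X N \<longleftrightarrow>
     N \<in> proj_points q \<and> (\<forall>L\<in>tangents q X. N \<in> L) \<and>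
     (\<forall>N'\<in>proj_points q. (\<forall>L\<in>tangents q X. N' \<in> L) \<longrightarrow> N' = N)"

definition affine_oval_with_nucleus_0 :: "nat \<Rightarrow> 'k::field set \<Rightarrow> bool" where
  "affine_oval_with_nucleus_0 q X \<longleftrightarrow>
     oval q (Affine ` X) \<and> nucleus q (Affine ` X) (Affine 0)"

end

theory Submission
  imports Defs "HOL-Computational_Algebra.Polynomial"
begin

text \<open>
  Splitting the Walsh sum at \<open>b\<close> along polar coordinates \<open>x = \<lambda>u\<close> and summing over \<open>\<lambda>\<close> first gives
  \<open>q (N b - 1)\<close>, where \<open>N b\<close> counts the \<open>u\<close> in \<open>S\<close> with \<open>g u + T (b u) = 0\<close>. So bentness forces
  \<open>N b\<close> to be 0 or 2 for all \<open>b\<close>, a condition invariant under replacing \<open>g u\<close> by \<open>g u + T (c u)\<close>.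
  The lines avoiding 0 are the lines \<open>T (b x) = 1\<close> and the line at infinity (\<open>b = 0\<close>), and such a line
  contains the point \<open>u / g u\<close> iff \<open>g u + T (b u) = 0\<close>; a line through 0 contains exactly one of these
  points. This gives the hyperoval, and shows that in the affine case the tangents are the lines
  through 0. The number of \<open>c\<close> with \<open>N c = 0\<close> comes from summing \<open>N c\<close> over all \<open>c\<close>: the total is
  \<open>q (q + 1)\<close>, since \<open>T (c u) = g u\<close> has \<open>q\<close> solutions \<open>c\<close> for each \<open>u\<close>.
\<close>

section \<open>Finite fields, and sums of bounded terms\<close>

text \<open>Translation by 1 permutes the field, so adding \<open>CARD('k)\<close> copies of 1
  leaves the sum of all elements unchanged.\<close>

lemma of_nat_CARD_eq_0: "of_nat CARD('k) = (0 :: 'k::{field,finite})"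
proof -
  have "(\<Sum>x\<in>UNIV. x) = (\<Sum>x\<in>UNIV. x + (1::'k))"
    by (rule sum.reindex_bij_witness[where i = "\<lambda>x. x + 1" and j = "\<lambda>x. x - 1"]) auto
  then show ?thesis
    by (simp add: sum.distrib)
qed

text \<open>Multiplication by a nonzero \<open>x\<close> permutes the nonzero elements and so
  preserves their product.\<close>

lemma power_CARD_eq: "x ^ CARD('k) = (x :: 'k::{field,finite})"
proof (cases "x = 0")
  case True
  then show ?thesis by simp
next
  case False
  have "prod (\<lambda>y. y) (UNIV - {0}) = prod (\<lambda>y. x * y) (UNIV - {0})"
    by (rule prod.reindex_bij_witness[where i = "\<lambda>y. x * y" and j = "\<lambda>y. y / x"])
      (use False in auto)
  also have "\<dots> = x ^ (CARD('k) - 1) * prod (\<lambda>y. y) (UNIV - {0})"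
    by (simp add: prod.distrib card_Diff_singleton)
  finally have "x ^ (CARD('k) - 1) = 1"
    by (simp add: prod_zero_iff)
  moreover have "CARD('k) = Suc (CARD('k) - 1)"
    using finite_UNIV_card_ge_0 by fastforce
  ultimately show ?thesis
    by (metis mult.right_neutral power_Suc)
qed

text \<open>Turns upper bounds on fibre sizes into equalities once the total is as large as the
  bounds allow.\<close>

lemma sum_eq_bound_imp_eq:
  fixes h :: "'a \<Rightarrow> nat"
  assumes "finite A" "\<And>x. x \<in> A \<Longrightarrow> h x \<le> n" "sum h A = card A * n" "x \<in> A"
  shows "h x = n"
proof (rule ccontr)
  assume "h x \<noteq> n"
  then have "h x < n" using assms by (simp add: order.not_eq_order_implies_strict)
  then have "sum h A < (\<Sum>_\<in>A. n)"
    using assms by (intro sum_strict_mono_ex1) auto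
  then show False using assms by simp
qed

definition rel_trace :: "nat \<Rightarrow> 'k::field \<Rightarrow> 'k" where
  "rel_trace q x = x + conj_q q x"

text \<open>Phrased through \<open>g\<close> alone, without lines, so that shifting \<open>g\<close>
  by a trace term merely permutes the \<open>b\<close>.\<close>

definition two_intersection :: "nat \<Rightarrow> ('k::field \<Rightarrow> 'k) \<Rightarrow> bool" where
  "two_intersection q g \<longleftrightarrow>
     (\<forall>b. card {u\<in>unit_circle q. g u + rel_trace q (b * u) = 0} \<in> {0, 2})"

text \<open>The case split is needed because \<open>u / 0 = 0\<close> would put the point at the
  origin.\<close>

definition slope_point :: "('k::field \<Rightarrow> 'k) \<Rightarrow> 'k \<Rightarrow> 'k proj_point" where
  "slope_point g u = (if g u = 0 then At_Infinity u else Affine (u / g u))"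

context
  fixes m q :: nat
  assumes q_eq: "q = 2 ^ m" and CARD_K: "CARD('k::{field,finite}) = q ^ 2"
begin

section \<open>Characteristic two\<close>

text \<open>The number of elements is a power of 2 and vanishes in the field, which has no nonzero
  nilpotents.\<close>

lemma two_eq_0: "(2::'k) = 0"
proof -
  have "(2::'k) ^ (m * 2) = 0"
    using of_nat_CARD_eq_0[where 'k = 'k] CARD_K q_eq by (simp add: power_mult)
  then show ?thesis by simp
qed

lemma add_self: "x + x = (0::'k)"
  by (metis mult_2 mult_zero_left two_eq_0)

lemma minus_eq: "- x = (x::'k)"
  by (metis add_self minus_unique)

lemma add_eq_0_iff_eq: "x + y = 0 \<longleftrightarrow> x = (y::'k)"
  by (metis add_self add_right_cancel)

lemma power_two_power_add: "(x + y) ^ (2 ^ i) = x ^ (2 ^ i) + (y::'k) ^ (2 ^ i)"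
proof (induction i)
  case (Suc i)
  have "(x + y) ^ (2 ^ Suc i) = ((x + y) ^ (2 ^ i)) ^ 2"
    by (simp only: power_Suc2 power_mult)
  also have "\<dots> = (x ^ (2 ^ i)) ^ 2 + (y ^ (2 ^ i)) ^ 2"
    by (simp add: Suc power2_sum two_eq_0)
  finally show ?case
    by (simp only: power_Suc2 power_mult)
qed simp

lemma q_pos: "q > 0"
  by (simp add: q_eq)

lemma q_gt_1: "m \<ge> 1 \<Longrightarrow> q > 1"
  using one_less_power[of "2::nat" m] by (simp add: q_eq)

section \<open>Conjugation, the subfield and the unit circle\<close>

lemma conj_add: "conj_q q (x + y) = conj_q q x + conj_q q (y::'k)"
  by (simp add: conj_q_def q_eq power_two_power_add)

lemma conj_mult: "conj_q q (x * y) = conj_q q x * conj_q q (y::'k)"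
  by (simp add: conj_q_def power_mult_distrib)

lemma conj_divide: "conj_q q (x / y) = conj_q q x / conj_q q (y::'k)"
  by (simp add: conj_q_def power_divide)

lemma conj_conj: "conj_q q (conj_q q x) = (x::'k)"
  using power_CARD_eq[of x] CARD_K
  by (simp add: conj_q_def power2_eq_square flip: power_mult)

lemma conj_0: "conj_q q (0::'k) = 0"
  using q_pos by (simp add: conj_q_def)

lemma subfield_iff: "x \<in> subfield_q q \<longleftrightarrow> conj_q q x = (x::'k)"
  by (simp add: subfield_q_def conj_q_def)

lemma circle_iff: "x \<in> unit_circle q \<longleftrightarrow> x * conj_q q x = (1::'k)"
  by (simp add: unit_circle_def)

lemma one_circle: "(1::'k) \<in> unit_circle q"
  by (simp add: circle_iff conj_q_def)

lemma zero_notin_circle: "(0::'k) \<notin> unit_circle q"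
  by (simp add: circle_iff)

lemma circle_nonzero: "u \<in> unit_circle q \<Longrightarrow> u \<noteq> (0::'k)"
  using zero_notin_circle by blast

lemma zero_subfield: "(0::'k) \<in> subfield_q q"
  by (simp add: subfield_iff conj_0)

lemma add_subfield:
  "x \<in> subfield_q q \<Longrightarrow> y \<in> subfield_q q \<Longrightarrow> x + (y::'k) \<in> subfield_q q"
  by (simp add: subfield_iff conj_add)

lemma mult_subfield:
  "x \<in> subfield_q q \<Longrightarrow> y \<in> subfield_q q \<Longrightarrow> x * (y::'k) \<in> subfield_q q"
  by (simp add: subfield_iff conj_mult)

lemma divide_subfield:
  "x \<in> subfield_q q \<Longrightarrow> y \<in> subfield_q q \<Longrightarrow> x / (y::'k) \<in> subfield_q q"
  by (simp add: subfield_iff conj_divide)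

text \<open>On the subfield the norm is the square, and in characteristic two 1 is the only square
  root of 1.\<close>

lemma subfield_inter_circle:
  assumes "x \<in> subfield_q q" "x \<in> unit_circle q"
  shows "x = (1::'k)"
proof -
  have "x * x = 1"
    using assms by (simp add: subfield_iff circle_iff)
  then have "x = 1 \<or> x = - 1"
    by (simp add: square_eq_1_iff)
  then show ?thesis
    by (simp add: minus_eq)
qed

text \<open>The quotient has norm 1 as well. Hence distinct circle elements span distinct lines
  through 0.\<close>

lemma circle_eq_if_divide_subfield:
  assumes "u \<in> unit_circle q" "v \<in> unit_circle q" "u / v \<in> subfield_q q"
  shows "u = (v::'k)"
proof -
  have "u / v \<in> unit_circle q"
    using assms(1,2) by (simp add: circle_iff conj_divide)
  from subfield_inter_circle[OF assms(3) this] show ?thesis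
    by (simp add: divide_eq_1_iff)
qed

section \<open>The relative trace\<close>

lemma rel_trace_add: "rel_trace q (x + y) = rel_trace q x + rel_trace q (y::'k)"
  by (simp add: rel_trace_def conj_add ac_simps)

lemma rel_trace_0: "rel_trace q (0::'k) = 0"
  by (simp add: rel_trace_def conj_0)

lemma rel_trace_scale: "t \<in> subfield_q q \<Longrightarrow> rel_trace q (t * x) = t * rel_trace q (x::'k)"
  by (simp add: rel_trace_def conj_mult subfield_iff distrib_left)

lemma rel_trace_divide: "t \<in> subfield_q q \<Longrightarrow> rel_trace q (x / t) = rel_trace q (x::'k) / t"
  by (simp add: rel_trace_def conj_divide subfield_iff add_divide_distrib)

text \<open>In characteristic two the sum of \<open>x\<close> and its conjugate vanishes exactly
  when they agree.\<close>

lemma rel_trace_eq_0_iff: "rel_trace q x = 0 \<longleftrightarrow> (x::'k) \<in> subfield_q q"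
  unfolding rel_trace_def subfield_iff add_eq_0_iff_eq by metis

lemma rel_trace_in_subfield: "rel_trace q (x::'k) \<in> subfield_q q"
  by (simp add: rel_trace_def subfield_iff conj_add conj_conj add.commute)

section \<open>Polar coordinates and the sizes of subfield, circle and trace fibres\<close>

lemma polar_inj:
  "inj_on (\<lambda>(t, u). t * u) ((subfield_q q - {0}) \<times> (unit_circle q :: 'k set))"
proof -
  have "s = t \<and> u = v"
    if *: "s \<in> subfield_q q" "t \<in> subfield_q q" "s \<noteq> 0" "t \<noteq> 0"
      "u \<in> unit_circle q" "v \<in> unit_circle q" and eq: "s * u = t * v" for s t u v :: 'k
  proof -
    have "u / v = t / s"
      using eq * circle_nonzero by (simp add: field_simps)
    then have "u = v"
      using * divide_subfield circle_eq_if_divide_subfield by metis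
    then show ?thesis
      using eq * circle_nonzero by simp
  qed
  then show ?thesis
    by (auto simp: inj_on_def)
qed

text \<open>Dividing a nonzero element by the square root of its norm leaves an element of norm
  1.\<close>

lemma polar_image:
  assumes "m \<ge> 1"
  shows "(\<lambda>(t, u). t * u) ` ((subfield_q q - {0}) \<times> unit_circle q) = UNIV - {0::'k}"
proof (intro equalityI subsetI)
  fix x :: 'k
  assume "x \<in> UNIV - {0}"
  then have "x \<noteq> 0" by simp
  define n where "n = x * conj_q q x"
  \<comment> \<open>\<open>t\<close> is the square root of the norm \<open>n\<close> in the subfield\<close>
  define t where "t = n ^ (2 ^ (m - 1))"
  have n: "n \<in> subfield_q q"
    by (simp add: n_def subfield_iff conj_mult conj_conj mult.commute)
  have "n \<noteq> 0"
    using \<open>x \<noteq> 0\<close> by (simp add: n_def conj_q_def)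
  \<comment> \<open>This makes \<open>t * t\<close> equal to \<open>n ^ q\<close>, which is
    \<open>n\<close> on the subfield.\<close>
  have "q = 2 ^ (m - 1) * 2"
    using assms q_eq by (cases m) auto
  then have "t * t = n"
    using n by (simp add: t_def subfield_q_def flip: power2_eq_square power_mult)
  have t: "t \<in> subfield_q q"
    using n by (simp add: t_def subfield_q_def flip: power_mult)
      (metis mult.commute power_mult)
  have "t \<noteq> 0"
    using \<open>t * t = n\<close> \<open>n \<noteq> 0\<close> by auto
  have "x / t \<in> unit_circle q"
    using t \<open>t * t = n\<close> \<open>n \<noteq> 0\<close>
    by (simp add: circle_iff subfield_iff conj_divide n_def)
  then show "x \<in> (\<lambda>(t, u). t * u) ` ((subfield_q q - {0}) \<times> unit_circle q)"
    using t \<open>t \<noteq> 0\<close> by (intro image_eqI[where x = "(t, x / t)"]) auto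
qed (use zero_notin_circle in auto)

text \<open>Covers the equations of the subfield (\<open>x ^ q + x = 0\<close>), the circle
  (\<open>x ^ (q + 1) = 1\<close>) and the trace fibres (\<open>x ^ q + x = a\<close>). With
  \<open>n > 1\<close> the linear term does not touch the leading one.\<close>

lemma card_trinomial_roots_le:
  assumes "n > 1"
  shows "card {x::'k. x ^ n + b * x = a} \<le> n"
proof -
  define p where "p = monom 1 n + [:- a, b:]"
  have "degree p = n"
    unfolding p_def using assms
    by (subst degree_add_eq_left) (auto simp: degree_monom_eq)
  moreover have "{x. x ^ n + b * x = a} = {x. poly p x = 0}"
    by (auto simp: p_def poly_monom algebra_simps)
  moreover have "p \<noteq> 0"
    using \<open>degree p = n\<close> assms by auto
  ultimately show ?thesis
    using card_poly_roots_bound[of p] by simp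
qed

text \<open>Root counting bounds both sizes from above; polar coordinates fix the product
  \<open>(card F - 1) * card S\<close> at \<open>q ^ 2 - 1\<close>, so both bounds are
  attained.\<close>

lemma card_subfield_circle:
  assumes "m \<ge> 1"
  shows card_subfield: "card (subfield_q q :: 'k set) = q"
    and card_circle: "card (unit_circle q :: 'k set) = q + 1"
proof -
  let ?F = "subfield_q q :: 'k set" and ?S = "unit_circle q :: 'k set"
  have "q > 1"
    using assms by (rule q_gt_1)
  have F: "card ?F \<le> q"
    using card_trinomial_roots_le[OF \<open>q > 1\<close>, of 1 0]
    by (simp add: subfield_q_def add_eq_0_iff_eq)
  have S: "card ?S \<le> q + 1"
    using card_trinomial_roots_le[of "q + 1" 0 1] \<open>q > 1\<close>
    by (simp add: unit_circle_def conj_q_def)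
  have F': "card (?F - {0}) = card ?F - 1"
    using zero_subfield by (simp add: card_Diff_singleton)
  have "card (UNIV - {0::'k}) = card ((?F - {0}) \<times> ?S)"
    using polar_image[OF assms] card_image[OF polar_inj] by metis
  then have prod: "(card ?F - 1) * card ?S = (q - 1) * (q + 1)"
    using CARD_K by (simp add: card_cartesian_product F' card_Diff_singleton
        power2_eq_square algebra_simps diff_mult_distrib)
  have "card ?F - 1 = q - 1"
  proof (rule ccontr)
    assume "card ?F - 1 \<noteq> q - 1"
    with F have "card ?F - 1 < q - 1" by linarith
    then have "(card ?F - 1) * (q + 1) < (q - 1) * (q + 1)"
      by (intro mult_less_mono1) auto
    with S have "(card ?F - 1) * card ?S < (q - 1) * (q + 1)"
      using mult_le_mono2 le_less_trans by metis
    with prod show False by simp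
  qed
  then show "card ?F = q"
    using \<open>q > 1\<close> by linarith
  with prod have "(q - 1) * card ?S = (q - 1) * (q + 1)"
    by simp
  then show "card ?S = q + 1"
    using \<open>q > 1\<close> unfolding mult_cancel1 by linarith
qed

text \<open>The \<open>q\<close> fibres over the subfield have at most \<open>q\<close> elements
  each and together exhaust all \<open>q ^ 2\<close>.\<close>

lemma card_rel_trace_fiber:
  assumes "m \<ge> 1" "a \<in> subfield_q q"
  shows "card {x::'k. rel_trace q x = a} = q"
proof (rule sum_eq_bound_imp_eq[where A = "subfield_q q :: 'k set"])
  have "q > 1"
    using assms(1) by (rule q_gt_1)
  fix a :: 'k
  show "card {x::'k. rel_trace q x = a} \<le> q"
    using card_trinomial_roots_le[OF \<open>q > 1\<close>, of 1 a]
    by (simp add: rel_trace_def conj_q_def add.commute)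
next
  have "(\<Sum>a\<in>subfield_q q. card {x::'k. rel_trace q x = a})
      = card (\<Union>a\<in>subfield_q q. {x::'k. rel_trace q x = a})"
    by (subst card_UN_disjoint) auto
  also have "(\<Union>a\<in>subfield_q q. {x::'k. rel_trace q x = a}) = UNIV"
    using rel_trace_in_subfield by auto
  finally show "(\<Sum>a\<in>subfield_q q. card {x::'k. rel_trace q x = a})
      = card (subfield_q q :: 'k set) * q"
    by (simp add: CARD_K card_subfield[OF assms(1)] power2_eq_square)
qed (use assms in auto)

section \<open>The absolute trace and its character sums\<close>

lemma abs_trace_add: "abs_trace n (x + y) = abs_trace n x + abs_trace n (y::'k)"
  by (simp add: abs_trace_def power_two_power_add sum.distrib)

lemma abs_trace_0: "abs_trace n (0::'k) = 0"
  by (simp add: abs_trace_def zero_power)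

text \<open>Transitivity of the trace: the upper \<open>m\<close> exponents
  \<open>2 ^ (m + i)\<close> are those contributed by the conjugate.\<close>

lemma abs_trace_rel_trace: "abs_trace (2 * m) x = abs_trace m (rel_trace q (x::'k))"
proof -
  have "(\<Sum>i<m + n. x ^ (2 ^ i)) = (\<Sum>i<m. x ^ (2 ^ i)) + (\<Sum>i<n. x ^ (2 ^ (m + i)))" for n
    by (induction n) (simp_all add: add.assoc)
  then have "abs_trace (2 * m) x = (\<Sum>i<m. x ^ (2 ^ i)) + (\<Sum>i<m. x ^ (2 ^ (m + i)))"
    unfolding abs_trace_def mult_2 .
  then show ?thesis
    by (simp add: abs_trace_def rel_trace_def conj_q_def q_eq power_two_power_add
        sum.distrib power_add power_mult)
qed

text \<open>Squaring shifts the sum of conjugates cyclically, as \<open>x ^ (2 ^ m) = x\<close>; so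
  the trace equals its own square.\<close>

lemma abs_trace_in_F2:
  assumes "x \<in> subfield_q q"
  shows "abs_trace m x \<in> {0, 1::'k}"
proof -
  have sq: "(\<Sum>i<n. x ^ (2 ^ i)) ^ 2 = (\<Sum>i<n. x ^ (2 ^ Suc i))" for n
  proof (induction n)
    case (Suc n)
    have "(\<Sum>i<Suc n. x ^ (2 ^ i)) ^ 2 = (\<Sum>i<n. x ^ (2 ^ i)) ^ 2 + (x ^ (2 ^ n)) ^ 2"
      by (simp add: power2_sum two_eq_0)
    then show ?case
      by (simp only: Suc sum.lessThan_Suc power_Suc2 power_mult)
  qed simp
  have "abs_trace m x ^ 2 + x = (\<Sum>i<Suc m. x ^ (2 ^ i))"
    unfolding sum.lessThan_Suc_shift abs_trace_def sq by (simp add: add.commute)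
  also have "\<dots> = abs_trace m x + x"
    using assms by (simp add: abs_trace_def subfield_q_def q_eq)
  finally have "abs_trace m x * (abs_trace m x - 1) = 0"
    by (simp add: power2_eq_square algebra_simps)
  then show ?thesis by auto
qed

text \<open>The trace is a polynomial of degree below \<open>q\<close>, nonzero because its linear
  coefficient is 1, so it cannot vanish on all \<open>q\<close> elements of the subfield.\<close>

lemma abs_trace_nontrivial:
  assumes "m \<ge> 1"
  obtains x :: 'k where "x \<in> subfield_q q" "abs_trace m x \<noteq> 0"
proof -
  define p :: "'k poly" where "p = (\<Sum>i<m. monom 1 (2 ^ i))"
  have "coeff p 1 = (\<Sum>i<m. if i = 0 then 1 else 0)"
    unfolding p_def coeff_sum by (intro sum.cong) auto
  then have "p \<noteq> 0"
    using assms by auto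
  have "degree p \<le> 2 ^ (m - 1)"
    unfolding p_def
    by (intro degree_sum_le) (auto simp: degree_monom_eq intro!: power_increasing)
  also have "(2::nat) ^ (m - 1) < q"
    using assms q_eq by simp
  finally have "card {x. poly p x = 0} < card (subfield_q q :: 'k set)"
    using card_poly_roots_bound[OF \<open>p \<noteq> 0\<close>] card_subfield[OF assms] by simp
  then have "\<not> subfield_q q \<subseteq> {x. poly p x = 0}"
    by (metis card_mono finite leD)
  then show ?thesis
    using that by (auto simp: p_def abs_trace_def poly_sum poly_monom)
qed

text \<open>Orthogonality of additive characters: for \<open>a \<noteq> 0\<close> a suitable
  translation flips every sign, so the sum is its own negative.\<close>

lemma sum_sign_abs_trace:
  assumes "m \<ge> 1" "a \<in> subfield_q q"
  shows "(\<Sum>t\<in>subfield_q q. sign_F2 (abs_trace m (t * (a::'k)))) = (if a = 0 then int q else 0)"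
proof (cases "a = 0")
  case True
  then show ?thesis
    by (simp add: abs_trace_0 sign_F2_def card_subfield[OF assms(1)])
next
  case False
  let ?\<chi> = "\<lambda>t::'k. sign_F2 (abs_trace m (t * a))"
  obtain x where x: "x \<in> subfield_q q" "abs_trace m x \<noteq> (0::'k)"
    using abs_trace_nontrivial assms by blast
  have x1: "abs_trace m x = 1"
    using x abs_trace_in_F2 by blast
  \<comment> \<open>Chosen so that \<open>y * a = x\<close> has trace 1.\<close>
  define y where "y = x / a"
  have y: "y \<in> subfield_q q"
    using x assms divide_subfield y_def by simp
  have ya: "(t + y) * a = t * a + x" for t
    using False by (simp add: y_def distrib_right)
  have shift: "?\<chi> (t + y) = - ?\<chi> t" if "t \<in> subfield_q q" for t
  proof -
    have "abs_trace m (t * a) \<in> {0, 1}"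
      using that assms by (intro abs_trace_in_F2 mult_subfield)
    then show ?thesis
      by (auto simp: ya abs_trace_add x1 sign_F2_def add_self)
  qed
  have "(\<Sum>t\<in>subfield_q q. ?\<chi> t) = (\<Sum>t\<in>subfield_q q. ?\<chi> (t + y))"
    by (rule sum.reindex_bij_witness[where i = "\<lambda>t. t + y" and j = "\<lambda>t. t + y"])
      (use y in \<open>auto simp: add.assoc add_self intro: add_subfield\<close>)
  also have "\<dots> = - (\<Sum>t\<in>subfield_q q. ?\<chi> t)"
    by (simp add: shift sum_negf)
  finally show ?thesis
    using False by simp
qed

section \<open>From bentness to intersection numbers, and the count of shifts\<close>

lemma bent_imp_two_intersection:
  fixes g f :: "'k \<Rightarrow> 'k"
  assumes m: "m \<ge> 1"
    and g: "\<forall>u\<in>unit_circle q. g u \<in> subfield_q q"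
    and f: "\<forall>t\<in>subfield_q q. \<forall>u\<in>unit_circle q. f (t * u) = abs_trace m (t * g u)"
    and bent: "bent m f"
  shows "two_intersection q g"
  unfolding two_intersection_def
proof
  fix b :: 'k
  let ?F = "subfield_q q :: 'k set" and ?S = "unit_circle q :: 'k set"
  let ?h = "\<lambda>u. g u + rel_trace q (b * u)"
  let ?G = "\<lambda>x. sign_F2 (f x + abs_trace (2 * m) (b * x))"
  let ?N = "card {u\<in>?S. ?h u = 0}"
  have h: "?h u \<in> ?F" if "u \<in> ?S" for u
    using that g rel_trace_in_subfield add_subfield by simp
  \<comment> \<open>By transitivity of the trace the exponent on each ray is the trace of a multiple
    of \<open>t\<close>.\<close>
  have val: "?G (t * u) = sign_F2 (abs_trace m (t * ?h u))" if "t \<in> ?F" "u \<in> ?S" for t u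
  proof -
    have "abs_trace (2 * m) (b * (t * u)) = abs_trace m (t * rel_trace q (b * u))"
      using rel_trace_scale[OF that(1), of "b * u"]
      by (simp add: abs_trace_rel_trace mult.left_commute)
    then show ?thesis
      using f that by (simp add: distrib_left abs_trace_add)
  qed
  \<comment> \<open>The term \<open>t = 0\<close>, equal to 1, is taken out because all rays share
    the origin.\<close>
  have inner: "(\<Sum>t\<in>?F - {0}. ?G (t * u)) = (if ?h u = 0 then int q else 0) - 1"
    if "u \<in> ?S" for u
  proof -
    have "(\<Sum>t\<in>?F. ?G (t * u)) = (if ?h u = 0 then int q else 0)"
      using sum_sign_abs_trace[OF m h[OF that]] val that by simp
    moreover have "?G (0 * u) = 1"
      using val[OF zero_subfield that] by (simp add: abs_trace_0 sign_F2_def)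
    ultimately show ?thesis
      using zero_subfield by (subst sum_diff1) auto
  qed
  have "(\<Sum>x\<in>UNIV. ?G x) = ?G 0 + (\<Sum>x\<in>UNIV - {0}. ?G x)"
    by (rule sum.remove) auto
  also have "(\<Sum>x\<in>UNIV - {0}. ?G x) = (\<Sum>(t, u)\<in>(?F - {0}) \<times> ?S. ?G (t * u))"
    unfolding polar_image[OF m, symmetric]
    by (subst sum.reindex[OF polar_inj]) (simp add: case_prod_beta)
  also have "\<dots> = (\<Sum>t\<in>?F - {0}. \<Sum>u\<in>?S. ?G (t * u))"
    by (rule sum.cartesian_product[symmetric])
  also have "\<dots> = (\<Sum>u\<in>?S. \<Sum>t\<in>?F - {0}. ?G (t * u))"
    by (rule sum.swap)
  also have "\<dots> = (\<Sum>u\<in>?S. (if ?h u = 0 then int q else 0) - 1)"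
    by (intro sum.cong refl inner)
  also have "\<dots> = int q * int ?N - int (q + 1)"
    by (simp add: sum_subtractf card_circle[OF m] sum.If_cases Int_def mult.commute)
  \<comment> \<open>The origin is the polar pair \<open>(0, 1)\<close>. Its 1 turns
    \<open>- (q + 1)\<close> into \<open>- q\<close>, which makes \<open>q\<close> a common
    factor.\<close>
  also have "?G 0 = 1"
    using val[OF zero_subfield one_circle] by (simp add: abs_trace_0 sign_F2_def)
  finally have "(\<Sum>x\<in>UNIV. ?G x) = int q * (int ?N - 1)"
    by (simp add: algebra_simps)
  moreover have "(\<Sum>x\<in>UNIV. ?G x) \<in> {int q, - int q}"
    using bent by (simp add: bent_def q_eq)
  ultimately have "int q * (int ?N - 1) \<in> {int q * 1, int q * (- 1)}"
    by (simp only: mult_1_right mult_minus1_right)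
  moreover have "int q \<noteq> 0"
    using q_pos by simp
  ultimately have "int ?N - 1 = 1 \<or> int ?N - 1 = - 1"
    by (simp only: mult_cancel_left insert_iff empty_iff simp_thms)
  then have "?N = 2 \<or> ?N = 0"
    by linarith
  then show "?N \<in> {0, 2}"
    by blast
qed

text \<open>Additivity of the trace absorbs \<open>c\<close> into \<open>b\<close>, which ranges
  over the whole field.\<close>

lemma two_intersection_shift:
  fixes g :: "'k \<Rightarrow> 'k"
  assumes "two_intersection q g"
  shows "two_intersection q (\<lambda>u. g u + rel_trace q (c * u))"
  using assms by (simp add: two_intersection_def add.assoc flip: rel_trace_add distrib_right)

lemma card_shifts_without_zero:
  fixes g :: "'k \<Rightarrow> 'k"
  assumes m: "m \<ge> 1"
    and g: "\<forall>u\<in>unit_circle q. g u \<in> subfield_q q"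
    and two: "two_intersection q g"
  shows "card {c. \<forall>u\<in>unit_circle q. g u + rel_trace q (c * u) \<noteq> 0} = q * (q - 1) div 2"
proof -
  let ?S = "unit_circle q :: 'k set"
  let ?N = "\<lambda>c. card {u\<in>?S. g u + rel_trace q (c * u) = 0}"
  let ?Z = "{c. \<forall>u\<in>?S. g u + rel_trace q (c * u) \<noteq> 0}"
  have Z: "c \<in> ?Z \<longleftrightarrow> ?N c = 0" for c
    by (auto simp: card_eq_0_iff)
  \<comment> \<open>The substitution \<open>x = c * u\<close> reduces this to a fibre of the
    trace.\<close>
  have fiber: "card {c. g u + rel_trace q (c * u) = 0} = q" if "u \<in> ?S" for u
  proof -
    have "bij_betw (\<lambda>c. c * u) {c. g u + rel_trace q (c * u) = 0} {x. rel_trace q x = g u}"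
      by (rule bij_betw_byWitness[where f' = "\<lambda>x. x / u"])
        (use that circle_nonzero in \<open>auto simp: add_eq_0_iff_eq add_self\<close>)
    then show ?thesis
      using bij_betw_same_card card_rel_trace_fiber m g that by metis
  qed
  have "2 * card (- ?Z) = (\<Sum>c\<in>- ?Z. ?N c)"
    using two Z by (subst sum.cong[where h = "\<lambda>_. 2"]) (auto simp: two_intersection_def)
  also have "\<dots> = (\<Sum>c\<in>UNIV. ?N c)"
    using Z by (intro sum.mono_neutral_left) auto
  \<comment> \<open>Double counting of the pairs \<open>(c, u)\<close> at which the shifted function
    vanishes.\<close>
  also have "\<dots> = (\<Sum>u\<in>?S. card {c\<in>UNIV. g u + rel_trace q (c * u) = 0})"
    using sum_multicount_gen[of UNIV ?S "\<lambda>c u. g u + rel_trace q (c * u) = 0", OF _ _ ballI[OF refl]]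
    by simp
  also have "\<dots> = (q + 1) * q"
    by (simp add: fiber card_circle[OF m])
  finally have "2 * card (- ?Z) = (q + 1) * q" .
  moreover have "card (- ?Z) = q ^ 2 - card ?Z" "card ?Z \<le> q ^ 2"
    using CARD_K card_mono[of UNIV ?Z] by (simp_all add: Compl_eq_Diff_UNIV card_Diff_subset)
  ultimately have "2 * card ?Z + (q + 1) * q = 2 * q ^ 2"
    by linarith
  then have "2 * card ?Z = q * (q - 1)"
    by (simp add: power2_eq_square algebra_simps diff_mult_distrib2)
  then show ?thesis by simp
qed

section \<open>Lines as level sets of the trace, and their intersection numbers\<close>

text \<open>Since \<open>conj_q q v = 1 / v\<close>, the kernel of this linear form consists of the
  subfield multiples of \<open>v\<close>, so its level sets are the lines of direction
  \<open>v\<close>.\<close>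

lemma mem_affine_line_iff:
  assumes "v \<in> unit_circle q"
  shows "x \<in> affine_line q a v \<longleftrightarrow> rel_trace q (conj_q q v * x) = rel_trace q (conj_q q v * (a::'k))"
proof -
  have v: "conj_q q v = 1 / v"
    using assms circle_nonzero by (simp add: circle_iff field_simps)
  have "x \<in> affine_line q a v \<longleftrightarrow> (x + a) / v \<in> subfield_q q"
  proof
    assume "x \<in> affine_line q a v"
    then obtain t where t: "x = a + t * v" "t \<in> subfield_q q"
      by (auto simp: affine_line_def)
    have "x + a = t * v"
      unfolding t(1) by (metis add.assoc add.commute add.right_neutral add_self)
    then show "(x + a) / v \<in> subfield_q q"
      unfolding \<open>x + a = t * v\<close> using t(2) circle_nonzero[OF assms] by simp
  next
    assume *: "(x + a) / v \<in> subfield_q q"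
    have "x = a + (x + a)"
      by (metis add.assoc add.commute add.right_neutral add_self)
    then have "x = a + (x + a) / v * v"
      using circle_nonzero[OF assms] by simp
    then show "x \<in> affine_line q a v"
      using * unfolding affine_line_def by blast
  qed
  then show ?thesis
    by (simp add: v add_divide_distrib rel_trace_add add_eq_0_iff_eq flip: rel_trace_eq_0_iff)
qed

lemma rel_trace_conj_mult_eq_0_iff:
  assumes "u \<in> unit_circle q" "v \<in> unit_circle q"
  shows "rel_trace q (conj_q q v * u) = 0 \<longleftrightarrow> u = (v::'k)"
proof -
  have v: "conj_q q v * u = u / v"
    using assms circle_nonzero by (simp add: circle_iff field_simps)
  show ?thesis
    unfolding rel_trace_eq_0_iff v
    using assms circle_eq_if_divide_subfield circle_nonzero
    by (auto simp: subfield_iff conj_q_def)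
qed

text \<open>The points lie in pairwise different directions from the origin.\<close>

lemma slope_point_inj:
  fixes g :: "'k \<Rightarrow> 'k"
  assumes g: "\<forall>u\<in>unit_circle q. g u \<in> subfield_q q"
  shows "inj_on (slope_point g) (unit_circle q)"
proof (rule inj_onI)
  fix u v
  assume *: "u \<in> unit_circle q" "v \<in> unit_circle q" "slope_point g u = slope_point g v"
  show "u = v"
  proof (cases "g u = 0 \<or> g v = 0")
    case True
    then show ?thesis
      using * by (auto simp: slope_point_def split: if_splits)
  next
    case False
    then have "u / v = g u / g v"
      using * circle_nonzero by (auto simp: slope_point_def field_simps)
    then show ?thesis
      using * g divide_subfield circle_eq_if_divide_subfield by metis
  qed
qed

text \<open>Clearing the denominator \<open>g u\<close> gives an equation that also covers the point
  at infinity, where it reduces to \<open>u = v\<close>.\<close>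

lemma slope_point_mem_line_iff:
  fixes g :: "'k \<Rightarrow> 'k"
  assumes "u \<in> unit_circle q" "v \<in> unit_circle q" "g u \<in> subfield_q q"
  shows "slope_point g u \<in> insert (At_Infinity v) (Affine ` affine_line q a v) \<longleftrightarrow>
    rel_trace q (conj_q q v * u) = g u * rel_trace q (conj_q q v * a)"
proof (cases "g u = 0")
  case True
  then show ?thesis
    using assms by (auto simp: slope_point_def rel_trace_conj_mult_eq_0_iff)
next
  case False
  have "rel_trace q (conj_q q v * (u / g u)) = rel_trace q (conj_q q v * u) / g u"
    using rel_trace_divide[OF assms(3)] by simp
  then show ?thesis
    using False by (auto simp: slope_point_def mem_affine_line_iff[OF assms(2)] field_simps)
qed

lemma zero_mem_line_iff:
  assumes "v \<in> unit_circle q"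
  shows "Affine (0::'k) \<in> insert (At_Infinity v) (Affine ` affine_line q a v) \<longleftrightarrow>
    rel_trace q (conj_q q v * a) = 0"
  by (auto simp: mem_affine_line_iff[OF assms] rel_trace_0)

text \<open>The right-hand side of the incidence equation vanishes here, leaving only the direction
  of the line.\<close>

lemma line_through_0_inter:
  fixes g :: "'k \<Rightarrow> 'k"
  assumes g: "\<forall>u\<in>unit_circle q. g u \<in> subfield_q q"
    and L: "L \<in> proj_lines q" "Affine 0 \<in> L"
  shows "\<exists>v. {u\<in>unit_circle q. slope_point g u \<in> L} = {v}"
proof -
  obtain a v where v: "v \<in> unit_circle q"
    and L_eq: "L = insert (At_Infinity v) (Affine ` affine_line q a v)"
    using L by (auto simp: proj_lines_def)
  have "slope_point g u \<in> L \<longleftrightarrow> u = v" if u: "u \<in> unit_circle q" for u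
    using L(2) slope_point_mem_line_iff[where g = g and a = a, OF u v] g u
      rel_trace_conj_mult_eq_0_iff[OF u v]
    unfolding L_eq zero_mem_line_iff[OF v] by simp
  then have "{u\<in>unit_circle q. slope_point g u \<in> L} = {v}"
    using v by blast
  then show ?thesis ..
qed

lemma line_avoiding_0_inter:
  fixes g :: "'k \<Rightarrow> 'k"
  assumes g: "\<forall>u\<in>unit_circle q. g u \<in> subfield_q q"
    and two: "two_intersection q g"
    and L: "L \<in> proj_lines q" "Affine 0 \<notin> L"
  shows "card {u\<in>unit_circle q. slope_point g u \<in> L} \<in> {0, 2}"
proof -
  have "\<exists>b. {u\<in>unit_circle q. slope_point g u \<in> L}
      = {u\<in>unit_circle q. g u + rel_trace q (b * u) = 0}"
  proof (cases "L = At_Infinity ` unit_circle q")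
    case True
    \<comment> \<open>The line at infinity corresponds to \<open>b = 0\<close>.\<close>
    have "{u\<in>unit_circle q. slope_point g u \<in> L}
        = {u\<in>unit_circle q. g u + rel_trace q (0 * u) = 0}"
      by (auto simp: True slope_point_def rel_trace_0)
    then show ?thesis ..
  next
    case False
    then obtain a v where v: "v \<in> unit_circle q"
      and L_eq: "L = insert (At_Infinity v) (Affine ` affine_line q a v)"
      using L by (auto simp: proj_lines_def)
    \<comment> \<open>The line has equation \<open>rel_trace q (conj_q q v * x) = d\<close>;
      dividing by \<open>d\<close> normalises the right-hand side to 1, with
      \<open>b = conj_q q v / d\<close>.\<close>
    define d where "d = rel_trace q (conj_q q v * a)"
    have "d \<noteq> 0"
      using L(2) unfolding L_eq zero_mem_line_iff[OF v] d_def .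
    have "slope_point g u \<in> L \<longleftrightarrow> g u + rel_trace q (conj_q q v / d * u) = 0"
      if u: "u \<in> unit_circle q" for u
    proof -
      have "rel_trace q (conj_q q v / d * u) = rel_trace q (conj_q q v * u) / d"
        using rel_trace_divide[of d "conj_q q v * u"] rel_trace_in_subfield d_def by simp
      moreover have "slope_point g u \<in> L \<longleftrightarrow> rel_trace q (conj_q q v * u) = g u * d"
        unfolding L_eq d_def using slope_point_mem_line_iff u v g by blast
      ultimately show ?thesis
        using \<open>d \<noteq> 0\<close> by (auto simp: add_eq_0_iff_eq field_simps)
    qed
    then show ?thesis by blast
  qed
  then show ?thesis
    using two unfolding two_intersection_def by metis
qed

lemma slope_points_inter_eq:
  "L \<inter> slope_point g ` unit_circle q
    = slope_point g ` {u\<in>unit_circle q. slope_point (g :: 'k \<Rightarrow> 'k) u \<in> L}"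
  by auto

lemma card_slope_points_inter:
  fixes g :: "'k \<Rightarrow> 'k"
  assumes g: "\<forall>u\<in>unit_circle q. g u \<in> subfield_q q"
  shows "card (L \<inter> slope_point g ` unit_circle q)
    = card {u\<in>unit_circle q. slope_point g u \<in> L}"
  unfolding slope_points_inter_eq
  by (intro card_image inj_on_subset[OF slope_point_inj[OF g]]) auto

section \<open>The hyperoval and the affine ovals\<close>

lemma slope_points_hyperoval:
  fixes g :: "'k \<Rightarrow> 'k"
  assumes m: "m \<ge> 1"
    and g: "\<forall>u\<in>unit_circle q. g u \<in> subfield_q q"
    and two: "two_intersection q g"
  shows "hyperoval q (slope_point g ` unit_circle q \<union> {Affine 0})"
proof -
  let ?P = "slope_point g ` unit_circle q"
  have zero: "Affine 0 \<notin> ?P"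
    using circle_nonzero by (auto simp: slope_point_def)
  have "card ?P = q + 1"
    using card_image[OF slope_point_inj[OF g]] card_circle[OF m] by simp
  then have "card (?P \<union> {Affine 0}) = q + 2"
    using zero by simp
  moreover have "?P \<union> {Affine 0} \<subseteq> proj_points q"
    by (auto simp: slope_point_def proj_points_def)
  moreover have "no_three_collinear q (?P \<union> {Affine 0})"
    unfolding no_three_collinear_def
  proof (intro ballI impI notI, elim bexE conjE)
    fix P Q R L
    assume PQR: "P \<in> ?P \<union> {Affine 0}" "Q \<in> ?P \<union> {Affine 0}" "R \<in> ?P \<union> {Affine 0}"
      "P \<noteq> Q" "P \<noteq> R" "Q \<noteq> R" "P \<in> L" "Q \<in> L" "R \<in> L" and L: "L \<in> proj_lines q"
    have "card (L \<inter> (?P \<union> {Affine 0})) \<le> 2"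
    proof (cases "Affine 0 \<in> L")
      case True
      then have "card (L \<inter> ?P) = 1"
        using line_through_0_inter[OF g L] card_slope_points_inter[OF g, of L] by auto
      moreover have "L \<inter> (?P \<union> {Affine 0}) = insert (Affine 0) (L \<inter> ?P)"
        using True by auto
      ultimately show ?thesis
        using card_insert_le_m1[of 2 "L \<inter> ?P"] by simp
    next
      case False
      then have "L \<inter> (?P \<union> {Affine 0}) = L \<inter> ?P"
        by auto
      then show ?thesis
        using line_avoiding_0_inter[OF g two L False] card_slope_points_inter[OF g, of L]
        by (metis insert_iff empty_iff order_refl zero_le)
    qed
    moreover have "card {P, Q, R} \<le> card (L \<inter> (?P \<union> {Affine 0}))"
      using PQR by (intro card_mono) auto
    ultimately show False
      using PQR by simp
  qed
  ultimately show ?thesis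
    by (simp add: hyperoval_def)
qed

lemma affine_slope_points_oval:
  fixes g :: "'k \<Rightarrow> 'k"
  assumes m: "m \<ge> 1"
    and g: "\<forall>u\<in>unit_circle q. g u \<in> subfield_q q"
    and two: "two_intersection q g"
    and nz: "\<forall>u\<in>unit_circle q. g u \<noteq> 0"
  shows "affine_oval_with_nucleus_0 q ((\<lambda>u. u / g u) ` unit_circle q)"
proof -
  let ?P = "slope_point g ` unit_circle q"
  have P: "Affine ` (\<lambda>u. u / g u) ` unit_circle q = ?P"
    using nz by (auto simp: slope_point_def image_image intro!: image_cong)
  have "card ?P = q + 1"
    using card_image[OF slope_point_inj[OF g]] card_circle[OF m] by simp
  \<comment> \<open>Collinearity conditions pass from the hyperoval to its subset without the
    origin.\<close>
  then have "oval q ?P"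
    using slope_points_hyperoval[OF m g two]
    by (auto simp: oval_def hyperoval_def no_three_collinear_def)
  have tangents: "tangents q ?P = {L \<in> proj_lines q. Affine 0 \<in> L}"
    unfolding tangents_def card_slope_points_inter[OF g]
    using line_through_0_inter[OF g] line_avoiding_0_inter[OF g two] by fastforce
  \<comment> \<open>Uniqueness of the nucleus: two lines through 0 with different directions share
    only 0.\<close>
  have "N = Affine 0" if N: "\<forall>L\<in>proj_lines q. Affine 0 \<in> L \<longrightarrow> N \<in> L" for N :: "'k proj_point"
  proof -
    let ?L = "\<lambda>v. insert (At_Infinity v) (Affine ` affine_line q 0 v)"
    have "1 < card (unit_circle q :: 'k set)"
      using card_circle[OF m] q_pos by simp
    then obtain v w :: 'k where vw: "v \<in> unit_circle q" "w \<in> unit_circle q" "v \<noteq> w"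
      by (metis card_le_Suc0_iff_eq finite not_less One_nat_def)
    have "N \<in> ?L v" "N \<in> ?L w"
      using N vw(1,2) zero_mem_line_iff[of _ 0] by (auto simp: proj_lines_def rel_trace_0)
    then obtain s t where "N = Affine (s * v)" "s * v = t * w"
      "s \<in> subfield_q q" "t \<in> subfield_q q"
      using vw(3) by (auto simp: affine_line_def)
    moreover have "s = 0"
    proof (rule ccontr)
      assume "s \<noteq> 0"
      then have "v / w = t / s"
        using \<open>s * v = t * w\<close> vw circle_nonzero by (simp add: field_simps)
      then show False
        using vw circle_eq_if_divide_subfield divide_subfield \<open>s \<in> _\<close> \<open>t \<in> _\<close> by metis
    qed
    ultimately show ?thesis by simp
  qed
  then have "nucleus q ?P (Affine 0)"
    by (auto simp: nucleus_def tangents proj_points_def)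
  with \<open>oval q ?P\<close> show ?thesis
    by (simp add: affine_oval_with_nucleus_0_def P)
qed

end

theorem theorem3p5:
  fixes m q :: nat
    and g f :: "'k::{field,finite} \<Rightarrow> 'k"
  assumes "m \<ge> 1" and "q = 2 ^ m" and "CARD('k) = q ^ 2"
    and g: "\<forall>u\<in>unit_circle q. g u \<in> subfield_q q"
    and f_F2: "\<forall>x. f x \<in> {0, 1}"
    and f: "\<forall>t\<in>subfield_q q. \<forall>u\<in>unit_circle q. f (t * u) = abs_trace m (t * g u)"
    and bent: "bent m f"
  shows "((\<forall>u\<in>unit_circle q. g u \<noteq> 0) \<longrightarrow>
            affine_oval_with_nucleus_0 q ((\<lambda>u. u / g u) ` unit_circle q)) \<and>
         card {c. \<forall>u\<in>unit_circle q. g u + c * u + conj_q q c * conj_q q u \<noteq> 0}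
           = q * (q - 1) div 2 \<and>
         (\<forall>c. (\<forall>u\<in>unit_circle q. g u + c * u + conj_q q c * conj_q q u \<noteq> 0) \<longrightarrow>
            affine_oval_with_nucleus_0 q
              ((\<lambda>u. u / (g u + c * u + conj_q q c * conj_q q u)) ` unit_circle q)) \<and>
         hyperoval q
           ((\<lambda>u. if g u = 0 then At_Infinity u else Affine (u / g u)) ` unit_circle q
             \<union> {Affine 0})"
proof -
  note field = \<open>q = 2 ^ m\<close> \<open>CARD('k) = q ^ 2\<close>
  have two: "two_intersection q g"
    using bent_imp_two_intersection[OF field] assms by blast
  have shift: "g u + c * u + conj_q q c * conj_q q u = g u + rel_trace q (c * u)" for c u
    by (simp add: rel_trace_def conj_mult[OF field] add.assoc)
  \<comment> \<open>Shifted functions keep values in the subfield, so the oval lemma applies to them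
    too.\<close>
  have gc: "\<forall>u\<in>unit_circle q. g u + rel_trace q (c * u) \<in> subfield_q q" for c
    using g add_subfield[OF field] rel_trace_in_subfield[OF field] by blast
  show ?thesis
    unfolding shift
    using affine_slope_points_oval[OF field \<open>m \<ge> 1\<close> g two]
      card_shifts_without_zero[OF field \<open>m \<ge> 1\<close> g two]
      affine_slope_points_oval[OF field \<open>m \<ge> 1\<close> gc two_intersection_shift[OF field two]]
      slope_points_hyperoval[OF field \<open>m \<ge> 1\<close> g two, unfolded slope_point_def]
    by blast
qed

end
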